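(* As formal power series in $x$ with coefficients in $\mathbb{Q}[s,t]$, $$D^{(\mathsf{cpk},\mathsf{cdbl})}(s,t;x)=\frac{1}{1-sV(s,t;x)}.$$
   Context: Let $\mathfrak{D}_n$ be the set of derangements of $[n]=\{1,\dots,n\}$, i.e. permutations $\pi=\pi_1\cdots\pi_n$ (one-line notation, $\pi_i=\pi(i)$) with $\pi_i\ne i$ for all $i$. For a permutation $\pi$ of $[n]$, the letter $\pi_i$ is a cyclic peak if $i<\pi_i>\pi_{\pi_i}$, a cyclic double ascent if $i<\pi_i<\pi_{\pi_i}$, and a cyclic double descent if $i>\pi_i>\pi_{\pi_i}$. Let $\mathsf{cpk}(\pi)$ be the number of cyclic peaks of $\pi$ and $\mathsf{cdbl}(\pi)$ the total number of cyclic double ascents and cyclic double descents of $\pi$. Define $$D^{(\mathsf{cpk},\mathsf{cdbl})}(s,t;x)=1+\sum_{n=1}^\infty\Big(\sum_{\pi\in\mathfrak{D}_n}s^{\mathsf{cpk}(\pi)}t^{\mathsf{cdbl}(\pi)}\Big)\frac{x^n}{n!}.$$ The bivariate Chebyshev polynomials of the second kind are defined by $U_0(s,t)=1$, $U_1(s,t)=2t$, and $U_n(s,t)=2tU_{n-1}(s,t)-sU_{n-2}(s,t)$ for $n\ge2$. Define $V(s,t;x)=\sum_{n=0}^\infty U_n(s,t)\frac{x^{n+2}}{(n+2)!}$. *)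

theory Defs
  imports
    "HOL-Computational_Algebra.Computational_Algebra"
    "HOL-Combinatorics.Permutations"
begin

text \<open>
  The ring \<open>\<rat>[s,t]\<close> is modelled as \<open>\<rat>[s][t]\<close>, i.e. by the type \<^typ>\<open>rat poly poly\<close>.
\<close>

definition var_s :: "rat poly poly" where
  "var_s = [:[:0, 1:]:]"

definition var_t :: "rat poly poly" where
  "var_t = [:0, 1:]"

definition rat_const :: "rat \<Rightarrow> rat poly poly" where
  "rat_const c = [:[:c:]:]"

definition derangements :: "nat \<Rightarrow> (nat \<Rightarrow> nat) set" where
  "derangements n = {p. p permutes {1..n} \<and> (\<forall>i\<in>{1..n}. p i \<noteq> i)}"

text \<open>
  These are sets of letters \<open>p i\<close>, not of positions \<open>i\<close>.
\<close>

definition cyclic_peaks :: "nat \<Rightarrow> (nat \<Rightarrow> nat) \<Rightarrow> nat set" where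
  "cyclic_peaks n p = {p i |i. i \<in> {1..n} \<and> i < p i \<and> p i > p (p i)}"

definition cyclic_double_ascents :: "nat \<Rightarrow> (nat \<Rightarrow> nat) \<Rightarrow> nat set" where
  "cyclic_double_ascents n p = {p i |i. i \<in> {1..n} \<and> i < p i \<and> p i < p (p i)}"

definition cyclic_double_descents :: "nat \<Rightarrow> (nat \<Rightarrow> nat) \<Rightarrow> nat set" where
  "cyclic_double_descents n p = {p i |i. i \<in> {1..n} \<and> i > p i \<and> p i > p (p i)}"

definition cpk :: "nat \<Rightarrow> (nat \<Rightarrow> nat) \<Rightarrow> nat" where
  "cpk n p = card (cyclic_peaks n p)"

definition cdbl :: "nat \<Rightarrow> (nat \<Rightarrow> nat) \<Rightarrow> nat" where
  "cdbl n p = card (cyclic_double_ascents n p) + card (cyclic_double_descents n p)"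

definition D_cpk_cdbl :: "rat poly poly \<Rightarrow> rat poly poly \<Rightarrow> rat poly poly fps" where
  "D_cpk_cdbl s t = 1 + Abs_fps (\<lambda>n. if n \<ge> 1
     then rat_const (1 / fact n) * (\<Sum>p\<in>derangements n. s ^ cpk n p * t ^ cdbl n p)
     else 0)"

fun cheb_U :: "nat \<Rightarrow> 'a::comm_ring_1 \<Rightarrow> 'a \<Rightarrow> 'a" where
  "cheb_U 0 s t = 1"
| "cheb_U (Suc 0) s t = 2 * t"
| "cheb_U (Suc (Suc n)) s t = 2 * t * cheb_U (Suc n) s t - s * cheb_U n s t"

text \<open>
  The coefficient of \<open>x\<^sup>m\<close> in \<open>\<Sum>n\<ge>0. U\<^sub>n(s,t) x\<^sup>n\<^sup>+\<^sup>2 / (n+2)!\<close>, with \<open>m = n + 2\<close>.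
\<close>

definition V :: "rat poly poly \<Rightarrow> rat poly poly \<Rightarrow> rat poly poly fps" where
  "V s t = Abs_fps (\<lambda>m. if m \<ge> 2 then rat_const (1 / fact m) * cheb_U (m - 2) s t else 0)"

text \<open>
  Library division of power series needs coefficients with a (total) inverse operation, which
  \<^typ>\<open>rat poly poly\<close> does not have. The reciprocal of a series with constant term \<open>1\<close> exists
  over every commutative ring; for other series the value below is meaningless.
\<close>

definition fps_recip :: "'a::comm_ring_1 fps \<Rightarrow> 'a fps" where
  "fps_recip f = fps_right_inverse f 1"

lemma fps_recip_unique:
  fixes f g :: "'a::comm_ring_1 fps"
  assumes "fps_nth f 0 = 1"
  shows "g = fps_recip f \<longleftrightarrow> g * f = 1"
proof -
  have 1: "f * fps_recip f = 1"
    unfolding fps_recip_def by (rule fps_right_inverse) (simp add: assms)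
  show ?thesis
  proof
    assume "g = fps_recip f"
    then show "g * f = 1" using 1 by (simp add: mult.commute)
  next
    assume "g * f = 1"
    then have "fps_recip f = (g * f) * fps_recip f" by simp
    also have "\<dots> = g" using 1 by (simp only: mult.assoc mult_1_right)
    finally show "g = fps_recip f" by simp
  qed
qed

lemma fps_nth_0_one_minus_V: "fps_nth (1 - fps_const s * V s t) 0 = 1"
  by (simp add: V_def)

end

theory Submission
  imports Defs
begin

text \<open>
  Removing the largest letter of a derangement gives
  \<open>d\<^sub>n\<^sub>+\<^sub>1 = s L d\<^sub>n + n s d\<^sub>n\<^sub>-\<^sub>1\<close> for the derangement polynomials \<open>d\<^sub>n\<close>, where
  \<open>L = 2 t \<partial>/\<partial>s + \<partial>/\<partial>t\<close>; hence \<open>D' = s L D + s x D\<close>. Since \<open>L U\<^sub>n = (n + 1) U\<^sub>n\<^sub>-\<^sub>1\<close>, the series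
  \<open>F = 1 - s V\<close> satisfies \<open>F' = s L F - s x F\<close>. As \<open>L\<close> is a derivation, \<open>E = D F\<close> satisfies
  \<open>E' = s L E\<close> with \<open>E(0) = 1\<close>, which forces \<open>E = 1\<close>.
\<close>

section \<open>Removing the largest letter\<close>

definition triple_weight :: "'r \<Rightarrow> 'r \<Rightarrow> 'a::linorder \<Rightarrow> 'a \<Rightarrow> 'a \<Rightarrow> 'r::comm_ring_1" where
  "triple_weight s t x y z =
     (if x < y \<and> z < y then s else if x < y \<and> y < z \<or> z < y \<and> y < x then t else 1)"

text \<open>A product over positions, so that a derivation can act on it one letter at a time. An
  arbitrary \<open>S\<close>, rather than an initial interval, absorbs the gap left by deleting a
  letter.\<close>

definition cycle_weight ::
    "'r \<Rightarrow> 'r \<Rightarrow> 'a::linorder set \<Rightarrow> ('a \<Rightarrow> 'a) \<Rightarrow> 'r::comm_ring_1" where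
  "cycle_weight s t S p = (\<Prod>i\<in>S. triple_weight s t i (p i) (p (p i)))"

definition derangements_on :: "'a set \<Rightarrow> ('a \<Rightarrow> 'a) set" where
  "derangements_on S = {p. p permutes S \<and> (\<forall>i\<in>S. p i \<noteq> i)}"

definition derangement_sum :: "'r \<Rightarrow> 'r \<Rightarrow> 'a::linorder set \<Rightarrow> 'r::comm_ring_1" where
  "derangement_sum s t S = (\<Sum>p\<in>derangements_on S. cycle_weight s t S p)"

lemma finite_derangements_on: "finite S \<Longrightarrow> finite (derangements_on S)"
  unfolding derangements_on_def by (rule finite_subset[OF _ finite_permutations[of S]]) auto

text \<open>Letters can be counted by their positions because \<open>p\<close> is injective. Double
  ascents and double descents are disjoint, so their contributions to the exponent of
  \<open>t\<close> add.\<close>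

lemma cycle_weight_eq_powers:
  assumes p: "p permutes {1..n}"
  shows "cycle_weight s t {1..n} p = s ^ cpk n p * t ^ cdbl n p"
proof -
  let ?P = "{i\<in>{1..n}. i < p i \<and> p (p i) < p i}"
  let ?A = "{i\<in>{1..n}. i < p i \<and> p i < p (p i)}"
  let ?B = "{i\<in>{1..n}. p (p i) < p i \<and> p i < i}"
  have inj: "inj_on p X" for X
    using p by (meson inj_on_subset permutes_inj subset_UNIV)
  have "cyclic_peaks n p = p ` ?P" "cyclic_double_ascents n p = p ` ?A"
    "cyclic_double_descents n p = p ` ?B"
    unfolding cyclic_peaks_def cyclic_double_ascents_def cyclic_double_descents_def by auto
  then have pk: "cpk n p = card ?P" and db: "cdbl n p = card ?A + card ?B"
    unfolding cpk_def cdbl_def using inj by (simp_all add: card_image)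
  have "card ?A + card ?B = card (?A \<union> ?B)"
    by (rule card_Un_disjoint[symmetric]) auto
  then have db': "cdbl n p = card (?A \<union> ?B)" using db by simp
  have "cycle_weight s t {1..n} p =
    (\<Prod>i\<in>{1..n}. (if i \<in> ?P then s else 1) * (if i \<in> ?A \<union> ?B then t else 1))"
    unfolding cycle_weight_def triple_weight_def by (rule prod.cong) auto
  also have "\<dots> = (\<Prod>i\<in>{1..n}. if i \<in> ?P then s else 1) * (\<Prod>i\<in>{1..n}. if i \<in> ?A \<union> ?B then t else 1)"
    by (rule prod.distrib)
  also have "(\<Prod>i\<in>{1..n}. if i \<in> ?P then s else 1) = s ^ card ?P"
    by (subst prod.inter_restrict[symmetric]) (auto intro!: arg_cong[where f="\<lambda>A. s ^ card A"])
  also have "(\<Prod>i\<in>{1..n}. if i \<in> ?A \<union> ?B then t else 1) = t ^ card (?A \<union> ?B)"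
    by (subst prod.inter_restrict[symmetric]) (auto intro!: arg_cong[where f="\<lambda>A. t ^ card A"])
  finally show ?thesis using pk db' by simp
qed

section \<open>Inserting a new letter into a derangement\<close>

text \<open>Composing with \<open>transpose N b\<close> places \<open>N\<close> just before
  \<open>b\<close> in a cycle of \<open>q\<close>. The result is fixed-point free exactly when
  \<open>b\<close> differs from \<open>N\<close> and \<open>q\<close> has no fixed point in
  \<open>S\<close> other than possibly \<open>b\<close>. If \<open>q\<close> fixes \<open>b\<close>,
  then \<open>N\<close> and \<open>b\<close> form a 2-cycle and \<open>q\<close> is a derangement of
  \<open>S - {b}\<close>.\<close>

lemma derangement_sum_insert:
  fixes f :: "('a \<Rightarrow> 'a) \<Rightarrow> 'r::comm_monoid_add"
  assumes S: "finite S" and N: "N \<notin> S"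
  shows "(\<Sum>p\<in>derangements_on (insert N S). f p) =
    (\<Sum>b\<in>S. (\<Sum>q\<in>derangements_on S. f (transpose N b \<circ> q)) +
             (\<Sum>q\<in>derangements_on (S - {b}). f (transpose N b \<circ> q)))"
proof -
  let ?Q = "\<lambda>b. {q. q permutes S \<and> (\<forall>i\<in>S. i \<noteq> b \<longrightarrow> q i \<noteq> i)}"
  let ?g = "\<lambda>(b, q). transpose N b \<circ> q"
  have split: "?Q b = derangements_on S \<union> derangements_on (S - {b})" if "b \<in> S" for b
  proof (intro equalityI subsetI)
    fix q assume q: "q \<in> ?Q b"
    show "q \<in> derangements_on S \<union> derangements_on (S - {b})"
    proof (cases "q b = b")
      case True
      have "q permutes (S - {b})"
        by (rule permutes_superset[of q S]) (use q True in auto)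
      then show ?thesis using q unfolding derangements_on_def by auto
    next
      case False
      then show ?thesis using q unfolding derangements_on_def by auto
    qed
  next
    fix q assume "q \<in> derangements_on S \<union> derangements_on (S - {b})"
    then show "q \<in> ?Q b"
      unfolding derangements_on_def using permutes_subset[of q "S - {b}" S] by auto
  qed
  have disj: "derangements_on S \<inter> derangements_on (S - {b}) = {}" if "b \<in> S" for b
    using that unfolding derangements_on_def
    by (auto simp: permutes_not_in)
  have bij: "bij_betw ?g (SIGMA b:S. ?Q b) (derangements_on (insert N S))"
  proof (rule bij_betw_imageI)
    show "inj_on ?g (SIGMA b:S. ?Q b)"
    proof (rule inj_onI, clarify)
      fix b q b' q'
      assume q: "q permutes S" "q' permutes S" and eq: "transpose N b \<circ> q = transpose N b' \<circ> q'"
      have "q N = N" "q' N = N" using q N by (auto simp: permutes_not_in)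
      then have b: "b = b'" using fun_cong[OF eq, of N] by simp
      have "transpose N b \<circ> (transpose N b \<circ> q) = transpose N b \<circ> (transpose N b \<circ> q')"
        using eq b by simp
      then have "q = q'" by (simp add: o_assoc)
      with b show "b = b' \<and> q = q'" by simp
    qed
    show "?g ` (SIGMA b:S. ?Q b) = derangements_on (insert N S)"
    proof (intro equalityI subsetI)
      fix p assume "p \<in> ?g ` (SIGMA b:S. ?Q b)"
      then obtain b q where bq: "b \<in> S" "q \<in> ?Q b" and p: "p = transpose N b \<circ> q" by auto
      have "p permutes insert N S"
        unfolding p
        by (rule permutes_compose) (use bq in \<open>auto intro: permutes_subset permutes_swap_id\<close>)
      moreover have "p i \<noteq> i" if "i \<in> insert N S" for i
      proof (cases "i = N")
        case True
        have "q N = N" using bq N by (auto simp: permutes_not_in)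
        then show ?thesis using True p bq N by auto
      next
        case False
        then have "i \<in> S" using that by simp
        then have "q i \<in> S" using bq by (simp add: permutes_in_image)
        then have "q i \<noteq> N" using N by auto
        show ?thesis
        proof (cases "q i = b")
          case True then show ?thesis using False p by simp
        next
          case ne: False
          then have "p i = q i" using \<open>q i \<noteq> N\<close> p by (simp add: transpose_apply_other)
          moreover have "q i \<noteq> i" using ne bq \<open>i \<in> S\<close> by auto
          ultimately show ?thesis by simp
        qed
      qed
      ultimately show "p \<in> derangements_on (insert N S)" unfolding derangements_on_def by simp
    next
      fix p assume p: "p \<in> derangements_on (insert N S)"
      then have pp: "p permutes insert N S" and nf: "\<And>i. i \<in> insert N S \<Longrightarrow> p i \<noteq> i"
        unfolding derangements_on_def by auto
      have "p \<in> {p. p permutes insert N S}" using pp by simp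
      then obtain b q where b: "b \<in> insert N S" and q: "q permutes S" and pq: "p = transpose N b \<circ> q"
        unfolding permutes_insert by auto
      have "q N = N" using q N by (simp add: permutes_not_in)
      then have "p N = b" using pq by simp
      then have "b \<in> S" using nf[of N] b by auto
      have "q i \<noteq> i" if "i \<in> S" "i \<noteq> b" for i
      proof
        assume "q i = i"
        then have "p i = i" using pq that N by (auto simp: transpose_def)
        then show False using nf that by blast
      qed
      then have "(b, q) \<in> (SIGMA b:S. ?Q b)" using \<open>b \<in> S\<close> q by auto
      then show "p \<in> ?g ` (SIGMA b:S. ?Q b)" using pq by force
    qed
  qed
  have fin: "finite (?Q b)" for b
    by (rule finite_subset[OF _ finite_permutations[OF S]]) auto
  have "(\<Sum>p\<in>derangements_on (insert N S). f p) = (\<Sum>bq\<in>(SIGMA b:S. ?Q b). f (?g bq))"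
    by (rule sum.reindex_bij_betw[OF bij, symmetric])
  also have "\<dots> = (\<Sum>b\<in>S. \<Sum>q\<in>?Q b. f (transpose N b \<circ> q))"
    using S fin by (subst sum.Sigma) (auto simp: case_prod_beta)
  also have "\<dots> = (\<Sum>b\<in>S. (\<Sum>q\<in>derangements_on S. f (transpose N b \<circ> q)) +
             (\<Sum>q\<in>derangements_on (S - {b}). f (transpose N b \<circ> q)))"
  proof (rule sum.cong)
    fix b assume b: "b \<in> S"
    show "(\<Sum>q\<in>?Q b. f (transpose N b \<circ> q)) = (\<Sum>q\<in>derangements_on S. f (transpose N b \<circ> q)) +
             (\<Sum>q\<in>derangements_on (S - {b}). f (transpose N b \<circ> q))"
      unfolding split[OF b]
      by (rule sum.union_disjoint) (use disj[OF b] S in \<open>auto intro: finite_derangements_on\<close>)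
  qed simp
  finally show ?thesis .
qed

text \<open>In the 2-cycle, \<open>N\<close> is a peak and \<open>b\<close> a valley, of weights
  \<open>s\<close> and 1; the other cycles are untouched.\<close>

lemma cycle_weight_insert_2cycle:
  assumes S: "finite S" and N: "\<And>i. i \<in> S \<Longrightarrow> i < N" and b: "b \<in> S" and q: "q permutes (S - {b})"
  shows "cycle_weight s t (insert N S) (transpose N b \<circ> q) = s * cycle_weight s t (S - {b}) q"
proof -
  let ?p = "transpose N b \<circ> q"
  have NS: "N \<notin> S" using N by blast
  have qN: "q N = N" and qb: "q b = b" using q NS by (auto simp: permutes_not_in)
  have qi: "q i \<in> S - {b}" if "i \<in> S - {b}" for i
    using permutes_in_image[OF q, of i] that by blast
  have pi: "?p i = q i" if "i \<in> S - {b}" for i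
    using qi[OF that] NS by (auto simp: transpose_def)
  have "cycle_weight s t (insert N S) ?p =
     triple_weight s t N (?p N) (?p (?p N)) * (triple_weight s t b (?p b) (?p (?p b)) *
     (\<Prod>i\<in>S - {b}. triple_weight s t i (?p i) (?p (?p i))))"
    unfolding cycle_weight_def prod.insert[OF S NS] by (subst prod.remove[OF S b]) (rule refl)
  also have "triple_weight s t N (?p N) (?p (?p N)) = 1"
    using qN qb N[OF b] by (simp add: triple_weight_def)
  also have "triple_weight s t b (?p b) (?p (?p b)) = s"
    using qN qb N[OF b] by (simp add: triple_weight_def)
  also have "(\<Prod>i\<in>S - {b}. triple_weight s t i (?p i) (?p (?p i))) = cycle_weight s t (S - {b}) q"
    unfolding cycle_weight_def by (rule prod.cong) (use pi qi in \<open>simp_all del: o_apply\<close>)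
  finally show ?thesis unfolding mult_1_left .
qed

text \<open>\<open>N\<close> goes into the edge from \<open>a\<close> to \<open>q a\<close>, giving
  the path \<open>x\<close>, \<open>a\<close>, \<open>N\<close>, \<open>q a\<close>,
  \<open>q (q a)\<close>, and the peak \<open>N\<close> yields the factor \<open>s\<close>. If the
  edge ascends, \<open>a\<close> still has a larger successor and keeps its type, so only the factor
  indexed by \<open>a\<close>, which classifies \<open>q a\<close>, changes. If it descends, only
  the factor indexed by \<open>x\<close>, which classifies \<open>a\<close>, changes.\<close>

lemma cycle_weight_insert_edge:
  assumes S: "finite S" and N: "\<And>i. i \<in> S \<Longrightarrow> i < N" and q: "q \<in> derangements_on S"
    and x: "x \<in> S" and a: "a = q x"
  defines "p \<equiv> transpose N (q a) \<circ> q"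
  shows "cycle_weight s t (insert N S) p =
    (if a < q a
     then s * triple_weight s t N (q a) (q (q a)) *
            (\<Prod>j\<in>S - {a}. triple_weight s t j (q j) (q (q j)))
     else s * triple_weight s t x a N *
            (\<Prod>j\<in>S - {x}. triple_weight s t j (q j) (q (q j))))"
proof -
  let ?g = "\<lambda>p i. triple_weight s t i (p i) (p (p i))"
  have NS: "N \<notin> S" using N by blast
  have qp: "q permutes S" and nf: "\<And>i. i \<in> S \<Longrightarrow> q i \<noteq> i"
    using q unfolding derangements_on_def by auto
  have inS: "q i \<in> S" if "i \<in> S" for i using qp that by (simp add: permutes_in_image)
  have inj: "q i = q j \<longleftrightarrow> i = j" for i j using qp permutes_inj by (metis injD)
  have qN: "q N = N" using qp NS by (simp add: permutes_not_in)
  have aS: "a \<in> S" using inS x a by simp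
  have xa: "x \<noteq> a" using nf[OF x] a by auto
  have pN: "p N = q a" and pa: "p a = N" using qN unfolding p_def by simp_all
  have pother: "p i = q i" if "i \<in> S" "i \<noteq> a" for i
    using that inS[OF that(1)] NS inj[of i a] unfolding p_def by (auto simp: transpose_def)
  have px: "p x = a" using pother[OF x xa] a by simp
  have gN: "?g p N = triple_weight s t N (q a) (q (q a))"
    using pN pother[OF inS[OF aS]] nf[OF aS] by simp
  have ga: "?g p a = s" using pa pN N[OF aS] N[OF inS[OF aS]] by (simp add: triple_weight_def)
  have gx: "?g p x = triple_weight s t x a N" using px pa by simp
  have gother: "?g p i = ?g q i" if "i \<in> S" "i \<noteq> a" "i \<noteq> x" for i
  proof -
    have "q i \<noteq> a" using that(3) a inj by auto
    then show ?thesis using pother[OF that(1,2)] pother[OF inS[OF that(1)]] by simp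
  qed
  let ?R = "\<Prod>j\<in>S - {a, x}. ?g q j"
  have Sax: "S - {a} - {x} = S - {a, x}" by auto
  have "(\<Prod>j\<in>insert N S. h j) = h N * (h a * (h x * (\<Prod>j\<in>S - {a, x}. h j)))" for h :: "'a \<Rightarrow> 'b"
  proof -
    have "prod h (insert N S) = h N * prod h S"
      by (rule prod.insert[OF S NS])
    also have "prod h S = h a * prod h (S - {a})"
      by (rule prod.remove[OF S aS])
    also have "prod h (S - {a}) = h x * prod h (S - {a} - {x})"
      by (rule prod.remove) (use S x xa in auto)
    finally show ?thesis unfolding Sax .
  qed
  then have "cycle_weight s t (insert N S) p = ?g p N * (?g p a * (?g p x * (\<Prod>j\<in>S - {a, x}. ?g p j)))"
    unfolding cycle_weight_def .
  also have "(\<Prod>j\<in>S - {a, x}. ?g p j) = ?R"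
    by (rule prod.cong) (use gother in auto)
  finally have w: "cycle_weight s t (insert N S) p =
    triple_weight s t N (q a) (q (q a)) * (s * (triple_weight s t x a N * ?R))"
    unfolding gN ga gx .
  have Sxa: "S - {x} - {a} = S - {a, x}" by auto
  have Ra: "(\<Prod>j\<in>S - {a}. ?g q j) = ?g q x * ?R"
    using prod.remove[of "S - {a}" x "?g q"] S x xa unfolding Sax by blast
  have Rx: "(\<Prod>j\<in>S - {x}. ?g q j) = ?g q a * ?R"
    using prod.remove[of "S - {x}" a "?g q"] S aS xa unfolding Sxa by blast
  show ?thesis
  proof (cases "a < q a")
    case True
    then have "triple_weight s t x a N = ?g q x"
      using a N[OF aS] by (auto simp: triple_weight_def)
    then show ?thesis using True w Ra by (simp add: mult_ac)
  next
    case False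
    then have "q a < a" using nf[OF aS] by (simp add: order.order_iff_strict)
    then have "triple_weight s t N (q a) (q (q a)) = ?g q a"
      using N[OF inS[OF aS]] by (auto simp: triple_weight_def)
    then show ?thesis using False w Rx by (simp add: mult_ac)
  qed
qed

section \<open>The derivation and its action on cycle weights\<close>

text \<open>The combinatorics uses only additivity, the Leibniz rule and the values at
  \<open>s\<close> and \<open>t\<close>; the concrete operator on Q[s,t] enters later as
  \<open>cheb_deriv\<close>.\<close>

locale chebyshev_derivation =
  fixes s t :: "'r::comm_ring_1" and L :: "'r \<Rightarrow> 'r"
  assumes L_add: "L (x + y) = L x + L y"
    and L_mult: "L (x * y) = L x * y + x * L y"
    and L_s: "L s = 2 * t"
    and L_t: "L t = 1"
begin

lemma L_0: "L 0 = 0"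
  using L_add[of 0 0] by simp

lemma L_1: "L 1 = 0"
  using L_mult[of 1 1] by simp

lemma L_minus: "L (- x) = - L x"
  using L_add[of x "- x"] L_0 by (simp add: eq_neg_iff_add_eq_0 add.commute)

lemma L_diff: "L (x - y) = L x - L y"
  using L_add[of x "- y"] L_minus by simp

lemma L_sum: "L (\<Sum>i\<in>A. f i) = (\<Sum>i\<in>A. L (f i))"
  by (induction A rule: infinite_finite_induct) (simp_all add: L_0 L_add)

lemma L_of_nat: "L (of_nat n) = 0"
  by (induction n) (simp_all add: L_0 L_add L_1)

lemma L_numeral: "L (numeral k) = 0"
  using L_of_nat[of "numeral k"] by simp

lemma L_prod:
  assumes "finite A"
  shows "L (\<Prod>i\<in>A. f i) = (\<Sum>i\<in>A. L (f i) * (\<Prod>j\<in>A - {i}. f j))"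
  using assms
proof induction
  case empty
  then show ?case by (simp add: L_1)
next
  case (insert a A)
  have "(\<Prod>j\<in>insert a A - {i}. f j) = f a * (\<Prod>j\<in>A - {i}. f j)" if "i \<in> A" for i
  proof -
    have "insert a A - {i} = insert a (A - {i})" using that insert by auto
    then show ?thesis using insert by simp
  qed
  then have "(\<Sum>i\<in>A. L (f i) * (\<Prod>j\<in>insert a A - {i}. f j)) =
      f a * (\<Sum>i\<in>A. L (f i) * (\<Prod>j\<in>A - {i}. f j))"
    by (simp add: sum_distrib_left mult_ac)
  then show ?case using insert by (simp add: L_mult)
qed

text \<open>
  Inserting \<open>N\<close> into an ascending edge changes only the type of its head, inserting it into a
  descending edge only the type of its tail. A peak is affected from both sides and becomes a double
  ascent or descent, which is \<open>L s = 2 t\<close>; a double ascent or descent is affected from one side and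
  becomes a valley, which is \<open>L t = 1\<close>.
\<close>

lemma sum_cycle_weight_insert:
  assumes S: "finite S" and N: "\<And>i. i \<in> S \<Longrightarrow> i < N" and q: "q \<in> derangements_on S"
  shows "(\<Sum>b\<in>S. cycle_weight s t (insert N S) (transpose N b \<circ> q)) = s * L (cycle_weight s t S q)"
proof -
  let ?g = "\<lambda>i. triple_weight s t i (q i) (q (q i))"
  let ?H = "\<lambda>i. \<Prod>j\<in>S - {i}. ?g j"
  \<comment> \<open>Both terms replace the factor \<open>?g i\<close> of the letter
    \<open>q i\<close>: in \<open>?A i\<close> the letter \<open>N\<close> enters an ascending edge
    ending at \<open>q i\<close>, in \<open>?B i\<close> a descending edge starting there.\<close>
  let ?A = "\<lambda>i. if i < q i then s * triple_weight s t N (q i) (q (q i)) * ?H i else 0"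
  let ?B = "\<lambda>i. if q i < q (q i) then 0 else s * triple_weight s t i (q i) N * ?H i"
  have qp: "q permutes S" and nf: "\<And>i. i \<in> S \<Longrightarrow> q i \<noteq> i"
    using q unfolding derangements_on_def by auto
  have inS: "q i \<in> S" if "i \<in> S" for i using qp that by (simp add: permutes_in_image)
  have re: "(\<Sum>i\<in>S. f (q i)) = (\<Sum>i\<in>S. f i)" for f :: "_ \<Rightarrow> 'r"
    using sum.permute[OF qp, of f] by (simp add: o_def)
  have AB: "?A i + ?B i = s * (L (?g i) * ?H i)" if "i \<in> S" for i
  proof -
    have *: "q i \<noteq> i" "q (q i) \<noteq> q i" "q i < N" using nf N inS that by auto
    consider "i < q i" "q (q i) < q i" | "i < q i" "q i < q (q i)" | "q i < i" "q (q i) < q i"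
      | "q i < i" "q i < q (q i)"
      using * by (meson linorder_neqE)
    then show ?thesis
      by cases (use * in \<open>auto simp: triple_weight_def L_s L_t L_1 algebra_simps\<close>)
  qed
  \<comment> \<open>Substituting \<open>b = q a\<close> and then \<open>a = q x\<close> turns the
    sum over \<open>b\<close> into a sum over edges from \<open>a\<close> to \<open>q a\<close>,
    with \<open>x\<close> the predecessor of \<open>a\<close>.\<close>
  have "(\<Sum>b\<in>S. cycle_weight s t (insert N S) (transpose N b \<circ> q)) =
      (\<Sum>x\<in>S. cycle_weight s t (insert N S) (transpose N (q (q x)) \<circ> q))"
    using re[of "\<lambda>b. cycle_weight s t (insert N S) (transpose N b \<circ> q)"]
      re[of "\<lambda>a. cycle_weight s t (insert N S) (transpose N (q a) \<circ> q)"] by simp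
  also have "\<dots> = (\<Sum>x\<in>S. ?A (q x) + ?B x)"
    by (rule sum.cong[OF refl], subst cycle_weight_insert_edge[OF S N q _ refl]) auto
  \<comment> \<open>Shifting only the \<open>?A\<close> part collects both changes of the same
    letter under one index.\<close>
  also have "\<dots> = (\<Sum>x\<in>S. ?A x) + (\<Sum>x\<in>S. ?B x)"
    using re[of ?A] by (simp add: sum.distrib)
  also have "\<dots> = (\<Sum>x\<in>S. s * (L (?g x) * ?H x))"
    unfolding sum.distrib[symmetric] by (rule sum.cong) (use AB in auto)
  also have "\<dots> = s * L (cycle_weight s t S q)"
    unfolding cycle_weight_def L_prod[OF S] by (simp add: sum_distrib_left)
  finally show ?thesis .
qed

text \<open>In the first double sum the order is exchanged: for a fixed \<open>q\<close>, the
  insertions of \<open>N\<close> at all places together give \<open>s * L\<close>. The second double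
  sum collects the 2-cycles of \<open>N\<close> with some \<open>b\<close>.\<close>

lemma derangement_sum_insert_Max:
  assumes S: "finite S" and N: "\<And>i. i \<in> S \<Longrightarrow> i < N"
  shows "derangement_sum s t (insert N S) =
    s * L (derangement_sum s t S) + s * (\<Sum>b\<in>S. derangement_sum s t (S - {b}))"
proof -
  have NS: "N \<notin> S" using N by blast
  let ?w = "\<lambda>b q. cycle_weight s t (insert N S) (transpose N b \<circ> q)"
  have "derangement_sum s t (insert N S) =
     (\<Sum>b\<in>S. \<Sum>q\<in>derangements_on S. ?w b q) + (\<Sum>b\<in>S. \<Sum>q\<in>derangements_on (S - {b}). ?w b q)"
    unfolding derangement_sum_def derangement_sum_insert[OF S NS] by (rule sum.distrib)
  also have "(\<Sum>b\<in>S. \<Sum>q\<in>derangements_on S. ?w b q) = (\<Sum>q\<in>derangements_on S. \<Sum>b\<in>S. ?w b q)"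
    by (rule sum.swap)
  also have "\<dots> = s * L (derangement_sum s t S)"
    unfolding derangement_sum_def L_sum sum_distrib_left
    by (rule sum.cong[OF refl]) (rule sum_cycle_weight_insert[OF S N])
  also have "(\<Sum>b\<in>S. \<Sum>q\<in>derangements_on (S - {b}). ?w b q) =
      s * (\<Sum>b\<in>S. derangement_sum s t (S - {b}))"
    unfolding derangement_sum_def sum_distrib_left
    by (intro sum.cong refl cycle_weight_insert_2cycle S N) (auto simp: derangements_on_def)
  finally show ?thesis .
qed

text \<open>At \<open>n = 0\<close> the truncated index \<open>n - 1\<close> is harmless, since its
  factor is \<open>of_nat 0\<close>.\<close>

fun derangement_poly :: "nat \<Rightarrow> 'r" where
  "derangement_poly 0 = 1"
| "derangement_poly (Suc n) =
     s * L (derangement_poly n) + s * (of_nat n * derangement_poly (n - 1))"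

text \<open>The induction runs over all sets of a given size, since deleting the maximum and then
  \<open>b\<close> can leave gaps. The terms of the sum over \<open>b\<close> become equal, which
  produces the factor \<open>of_nat n\<close>.\<close>

lemma derangement_sum_eq_poly:
  fixes S :: "'a::linorder set"
  assumes "finite S"
  shows "derangement_sum s t S = derangement_poly (card S)"
  using assms
proof (induction "card S" arbitrary: S rule: less_induct)
  case less
  show ?case
  proof (cases "S = {}")
    case True
    then show ?thesis
      by (simp add: derangement_sum_def derangements_on_def cycle_weight_def)
  next
    case False
    let ?T = "S - {Max S}"
    have ST: "insert (Max S) ?T = S" using less.prems False Max_in by blast
    have card: "card S = Suc (card ?T)" using less.prems False by (metis Max_in card_Suc_Diff1)
    have lt: "i < Max S" if "i \<in> ?T" for i
      using that less.prems Max_ge[of S i] by (simp add: order.strict_iff_order)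
    have "derangement_sum s t S =
        s * L (derangement_sum s t ?T) + s * (\<Sum>b\<in>?T. derangement_sum s t (?T - {b}))"
      using derangement_sum_insert_Max[of ?T "Max S"] lt less.prems unfolding ST by simp
    also have "derangement_sum s t ?T = derangement_poly (card ?T)"
      using less card by simp
    also have "(\<Sum>b\<in>?T. derangement_sum s t (?T - {b})) =
        (\<Sum>b\<in>?T. derangement_poly (card ?T - 1))"
    proof (rule sum.cong[OF refl])
      fix b assume b: "b \<in> ?T"
      have fT: "finite ?T" using less.prems by simp
      have c: "card (?T - {b}) = card ?T - 1" by (rule card_Diff_singleton[OF b])
      have "derangement_sum s t (?T - {b}) = derangement_poly (card (?T - {b}))"
        by (rule less.hyps) (use c card fT in auto)
      with c show "derangement_sum s t (?T - {b}) = derangement_poly (card ?T - 1)" by simp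
    qed
    finally show ?thesis by (simp add: card)
  qed
qed

section \<open>The differential equation\<close>

text \<open>Applying \<open>L\<close> to the recurrence and using induction gives
  \<open>2 U_(n-1) + n 2t U_(n-2) - 2t U_(n-2) - (n-1) s U_(n-3)\<close>, which the recurrence folds
  into \<open>(n+1) U_(n-1)\<close>. The conditional amounts to \<open>U_(-1) = 0\<close>.\<close>

lemma L_cheb_U: "L (cheb_U n s t) = of_nat (Suc n) * (if n = 0 then 0 else cheb_U (n - 1) s t)"
proof (induction n rule: less_induct)
  case (less n)
  \<comment> \<open>Splitting off 2 as well makes both induction hypotheses of the last case concern
    positive indices.\<close>
  consider "n = 0" | "n = 1" | "n = 2" | m where "n = Suc (Suc (Suc m))"
    by (metis One_nat_def Suc_1 not0_implies_Suc)
  then show ?case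
  proof cases
    case 4
    have "L (cheb_U (Suc (Suc m)) s t) = of_nat (Suc (Suc (Suc m))) * cheb_U (Suc m) s t"
      using less.IH[of "Suc (Suc m)"] 4 by simp
    moreover have "L (cheb_U (Suc m) s t) = of_nat (Suc (Suc m)) * cheb_U m s t"
      using less.IH[of "Suc m"] 4 by simp
    moreover have "cheb_U n s t = 2 * t * cheb_U (Suc (Suc m)) s t - s * cheb_U (Suc m) s t"
      using 4 by simp
    ultimately have "L (cheb_U n s t) = 2 * cheb_U (Suc (Suc m)) s t
        + 2 * t * (of_nat (Suc (Suc (Suc m))) * cheb_U (Suc m) s t)
        - (2 * t * cheb_U (Suc m) s t + s * (of_nat (Suc (Suc m)) * cheb_U m s t))"
      by (simp only: L_diff L_mult L_s L_t L_numeral mult_zero_left add_0_left mult_1_right)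
    also have "\<dots> = of_nat (Suc n) * cheb_U (n - 1) s t"
      using 4 by (simp add: algebra_simps)
    finally show ?thesis using 4 by simp
  qed (simp_all add: numeral_2_eq_2 L_diff L_mult L_s L_t L_1 L_numeral algebra_simps)
qed

end

section \<open>Exponential generating functions over Q[s,t]\<close>

definition egf :: "(nat \<Rightarrow> rat poly poly) \<Rightarrow> rat poly poly fps" where
  "egf a = Abs_fps (\<lambda>n. rat_const (1 / fact n) * a n)"

lemma rat_const_1: "rat_const 1 = 1"
  by (simp add: rat_const_def one_pCons)

lemma rat_const_mult: "rat_const (a * b) = rat_const a * rat_const b"
  by (simp add: rat_const_def)

lemma of_nat_eq_rat_const: "of_nat n = rat_const (of_nat n)"
  by (simp add: rat_const_def of_nat_poly)

lemma fps_deriv_egf: "fps_deriv (egf a) = egf (\<lambda>n. a (Suc n))"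
proof (rule fps_ext)
  fix n
  have "of_nat (Suc n) * rat_const (1 / fact (Suc n)) = rat_const (1 / fact n)"
    unfolding of_nat_eq_rat_const rat_const_mult[symmetric] by (simp add: divide_simps)
  then show "fps_deriv (egf a) $ n = egf (\<lambda>n. a (Suc n)) $ n"
    unfolding egf_def fps_deriv_nth by (simp flip: mult.assoc)
qed

lemma fps_X_mult_egf: "fps_X * egf a = egf (\<lambda>n. of_nat n * a (n - 1))"
proof (rule fps_ext)
  fix n
  show "(fps_X * egf a) $ n = egf (\<lambda>n. of_nat n * a (n - 1)) $ n"
  proof (cases n)
    case (Suc m)
    have "rat_const (1 / fact (Suc m)) * of_nat (Suc m) = rat_const (1 / fact m)"
      unfolding of_nat_eq_rat_const rat_const_mult[symmetric] by (simp add: divide_simps)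
    then show ?thesis using Suc by (simp add: egf_def flip: mult.assoc)
  qed (simp add: egf_def)
qed

lemma fps_const_mult_egf: "fps_const c * egf a = egf (\<lambda>n. c * a n)"
  by (rule fps_ext) (simp add: egf_def mult_ac)

lemma egf_add: "egf a + egf b = egf (\<lambda>n. a n + b n)"
  by (rule fps_ext) (simp add: egf_def algebra_simps)

lemma egf_diff: "egf a - egf b = egf (\<lambda>n. a n - b n)"
  by (rule fps_ext) (simp add: egf_def algebra_simps)

section \<open>The derivation on Q[s,t] and its extension to power series\<close>

text \<open>\<open>2 t \<partial>/\<partial>s + \<partial>/\<partial>t\<close>; the outer variable of \<^typ>\<open>rat poly poly\<close> is \<open>t\<close>.\<close>

definition cheb_deriv :: "rat poly poly \<Rightarrow> rat poly poly" where
  "cheb_deriv p = 2 * var_t * map_poly pderiv p + pderiv p"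

lemma pderiv_sum: "pderiv (\<Sum>i\<in>A. f i) = (\<Sum>i\<in>A. pderiv (f i))"
  using higher_pderiv_sum[of 1 f A] by simp

text \<open>\<open>map_poly pderiv\<close> is the partial derivative in the inner variable; its
  Leibniz rule follows coefficientwise from the convolution formula.\<close>

lemma map_poly_pderiv_mult:
  fixes p q :: "'a::idom poly poly"
  shows "map_poly pderiv (p * q) = map_poly pderiv p * q + p * map_poly pderiv q"
  by (rule poly_eqI)
    (simp add: coeff_map_poly coeff_mult pderiv_sum pderiv_mult sum.distrib[symmetric],
      simp add: add.commute mult.commute)

lemma map_poly_pderiv_add:
  fixes p q :: "'a::idom poly poly"
  shows "map_poly pderiv (p + q) = map_poly pderiv p + map_poly pderiv q"
  by (rule poly_eqI) (simp add: coeff_map_poly pderiv_add)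

lemma map_poly_pderiv_1: "map_poly pderiv (1 :: 'a::idom poly poly) = 0"
  by (rule poly_eqI) (simp add: coeff_map_poly coeff_1)

interpretation cheb: chebyshev_derivation var_s var_t cheb_deriv
proof
  fix p q :: "rat poly poly"
  show "cheb_deriv (p + q) = cheb_deriv p + cheb_deriv q"
    by (simp add: cheb_deriv_def map_poly_pderiv_add pderiv_add algebra_simps)
  show "cheb_deriv (p * q) = cheb_deriv p * q + p * cheb_deriv q"
    by (simp add: cheb_deriv_def map_poly_pderiv_mult pderiv_mult algebra_simps)
  show "cheb_deriv var_s = 2 * var_t"
    by (simp add: cheb_deriv_def var_s_def map_poly_pCons pderiv_pCons flip: one_pCons)
  show "cheb_deriv var_t = 1"
    by (simp add: cheb_deriv_def var_t_def map_poly_pCons pderiv_pCons map_poly_pderiv_1)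
qed

text \<open>Rational constants are killed by \<open>cheb_deriv\<close>, so it passes the factors
  \<open>1 / fact n\<close> in \<open>egf\<close>.\<close>

lemma cheb_deriv_rat_const_mult: "cheb_deriv (rat_const c * p) = rat_const c * cheb_deriv p"
proof -
  have "cheb_deriv (rat_const c) = 0"
    by (simp add: cheb_deriv_def rat_const_def map_poly_pCons pderiv_pCons)
  then show ?thesis by (simp add: cheb.L_mult)
qed

text \<open>The variable \<open>x\<close> is treated as a constant, so that the extension is again a
  derivation.\<close>

definition fps_cheb_deriv :: "rat poly poly fps \<Rightarrow> rat poly poly fps" where
  "fps_cheb_deriv f = Abs_fps (\<lambda>n. cheb_deriv (f $ n))"

lemma fps_cheb_deriv_mult: "fps_cheb_deriv (f * g) = fps_cheb_deriv f * g + f * fps_cheb_deriv g"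
  by (rule fps_ext)
    (simp add: fps_cheb_deriv_def fps_mult_nth cheb.L_sum cheb.L_mult sum.distrib)

lemma fps_cheb_deriv_egf: "fps_cheb_deriv (egf a) = egf (\<lambda>n. cheb_deriv (a n))"
  by (rule fps_ext) (simp add: fps_cheb_deriv_def egf_def cheb_deriv_rat_const_mult)

text \<open>Comparing coefficients gives \<open>(n+1) f_(n+1) = c L f_n\<close>. The coefficient of
  \<open>x\<close> vanishes because \<open>L 1 = 0\<close>, all later ones because
  \<open>L 0 = 0\<close>; the factor \<open>n+1\<close> cancels since Q[s,t] is a domain of
  characteristic 0.\<close>

lemma eq_1_if_fps_deriv_eq:
  assumes "f $ 0 = 1" and deriv: "fps_deriv f = fps_const c * fps_cheb_deriv f"
  shows "f = 1"
proof (rule fps_ext)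
  fix n
  have step: "f $ Suc n = 0" if "cheb_deriv (f $ n) = 0" for n
  proof -
    have "of_nat (Suc n) * f $ Suc n = 0"
      using arg_cong[OF deriv, of "\<lambda>h. h $ n"] that by (simp add: fps_cheb_deriv_def)
    then show ?thesis using of_nat_neq_0 by (metis mult_eq_0_iff)
  qed
  show "f $ n = (1 :: rat poly poly fps) $ n"
  proof (cases n)
    case (Suc m)
    have "f $ Suc m = 0"
      by (induction m) (rule step, simp add: assms cheb.L_0 cheb.L_1)+
    then show ?thesis using Suc by simp
  qed (simp add: assms)
qed

section \<open>The two generating functions and their product\<close>

lemma D_cpk_cdbl_eq_egf: "D_cpk_cdbl var_s var_t = egf cheb.derangement_poly"
proof (rule fps_ext)
  fix n
  have "derangements_on {1..n} = derangements n"
    by (simp add: derangements_on_def derangements_def)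
  then have "(\<Sum>p\<in>derangements n. var_s ^ cpk n p * var_t ^ cdbl n p) =
      derangement_sum var_s var_t {1..n}"
    unfolding derangement_sum_def
    by (intro sum.cong cycle_weight_eq_powers[symmetric]) (simp_all add: derangements_def)
  also have "\<dots> = cheb.derangement_poly n"
    by (simp add: cheb.derangement_sum_eq_poly)
  finally show "D_cpk_cdbl var_s var_t $ n = egf cheb.derangement_poly $ n"
    by (cases n) (simp_all add: D_cpk_cdbl_def egf_def rat_const_1)
qed

text \<open>These are \<open>n!\<close> times the coefficients of \<open>1 - s V\<close>. The shift
  by 2 comes from the powers \<open>x^(n+2)\<close> in \<open>V\<close>, which leave no linear
  term.\<close>

definition recip_coeff :: "nat \<Rightarrow> rat poly poly" where
  "recip_coeff n = (if n = 0 then 1 else if n = 1 then 0 else - var_s * cheb_U (n - 2) var_s var_t)"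

lemma one_minus_V_eq_egf: "1 - fps_const var_s * V var_s var_t = egf recip_coeff"
  by (rule fps_ext) (simp add: V_def egf_def recip_coeff_def rat_const_1)

text \<open>Coefficient form of \<open>F' = s L F - s x F\<close>. For \<open>n\<close> at least 3,
  \<open>L_cheb_U\<close> gives \<open>- (n-1) s^2 U_(n-3)\<close>, which combines with
  \<open>n s^2 U_(n-3)\<close> to \<open>s^2 U_(n-3)\<close>; what remains is \<open>- s\<close>
  times the Chebyshev recurrence.\<close>

lemma recip_coeff_Suc:
  "recip_coeff (Suc n) =
     var_s * cheb_deriv (recip_coeff n) - var_s * (of_nat n * recip_coeff (n - 1))"
proof -
  consider "n = 0" | "n = 1" | "n = 2" | m where "n = Suc (Suc (Suc m))"
    by (metis One_nat_def Suc_1 not0_implies_Suc)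
  then show ?thesis
    by cases (simp_all add: recip_coeff_def numeral_2_eq_2 cheb.L_0 cheb.L_1 cheb.L_minus
        cheb.L_mult cheb.L_s cheb.L_cheb_U algebra_simps del: cheb_U.simps(3), simp_all add: algebra_simps)
qed

theorem theorem7:
  shows "D_cpk_cdbl var_s var_t = fps_recip (1 - fps_const var_s * V var_s var_t)"
proof -
  let ?D = "egf cheb.derangement_poly" and ?F = "egf recip_coeff" and ?s = "fps_const var_s"
  have D: "fps_deriv ?D = ?s * fps_cheb_deriv ?D + ?s * (fps_X * ?D)"
    unfolding fps_deriv_egf fps_cheb_deriv_egf fps_X_mult_egf fps_const_mult_egf egf_add by simp
  have F: "fps_deriv ?F = ?s * fps_cheb_deriv ?F - ?s * (fps_X * ?F)"
    unfolding fps_deriv_egf fps_cheb_deriv_egf fps_X_mult_egf fps_const_mult_egf egf_diff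
    by (simp add: recip_coeff_Suc)
  have "?D * ?F = 1"
  proof (rule eq_1_if_fps_deriv_eq)
    show "(?D * ?F) $ 0 = 1"
      by (simp add: egf_def recip_coeff_def rat_const_1)
    \<comment> \<open>The terms \<open>s x D F\<close> coming from the two factors cancel; the rest
      is the Leibniz rule for \<open>fps_cheb_deriv\<close>.\<close>
    show "fps_deriv (?D * ?F) = ?s * fps_cheb_deriv (?D * ?F)"
      unfolding fps_deriv_mult fps_cheb_deriv_mult D F by (simp add: algebra_simps)
  qed
  then show ?thesis
    unfolding D_cpk_cdbl_eq_egf
    using fps_recip_unique[OF fps_nth_0_one_minus_V, of "?D" var_s var_t]
    by (simp add: one_minus_V_eq_egf)
qed

end
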